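(* Let $\mathcal{F}$ be a union-closed set family with $\left|\bigcup_{F\in\mathcal{F}}F\right|\ge 2$, and suppose that $\mathcal{F}$ is not a near-$2$-cube. If $f_2(\mathcal{F})\le \frac13$, then (i) $81\le |\mathcal{F}|\le 113$, and (ii) every minimal $2$-good set $S$ for $\mathcal{F}$ has size $4$.
   Context: A set family here is a finite family (set) of finite sets. A family $\mathcal{F}$ is union-closed if $A,B\in\mathcal{F}$ implies $A\cup B\in\mathcal{F}$. Its ground set is $\bigcup_{F\in\mathcal{F}}F$. The frequency of an element is the number of sets of $\mathcal{F}$ containing it. List the elements of the ground set in non-increasing order of frequency; $f_2(\mathcal{F})$ denotes the frequency of the second element in this list divided by $|\mathcal{F}|$. The elements are labelled so that $1$ denotes a most frequent element of $\mathcal{F}$. A near-$2$-cube is a family of the form $\{\varnothing,\{u\},C\}$, where $C$ is a set with $u\in C$ and $|C|\ge 2$. A set $S$ is $2$-good for $\mathcal{F}$ if $1\notin S$ and $S\cap A\ne\varnothing$ for each $A\in\mathcal{F}$ with $A\ne\varnothing$ and $A\neq\{1\}$. A $2$-good set is minimal if none of its proper subsets is $2$-good. *)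

theory Defs
  imports Complex_Main "HOL-Library.Multiset"
begin

definition set_family :: "'a set set \<Rightarrow> bool" where
  "set_family F \<longleftrightarrow> finite F \<and> (\<forall>A\<in>F. finite A)"

definition union_closed :: "'a set set \<Rightarrow> bool" where
  "union_closed F \<longleftrightarrow> (\<forall>A\<in>F. \<forall>B\<in>F. A \<union> B \<in> F)"

definition frequency :: "'a set set \<Rightarrow> 'a \<Rightarrow> nat" where
  "frequency F x = card {A \<in> F. x \<in> A}"

text \<open>The frequencies of the ground set elements, with repetition, in non-increasing order.
  Ties between elements do not affect this list; see the lemma below.\<close>

definition frequencies :: "'a set set \<Rightarrow> nat list" where
  "frequencies F = rev (sorted_list_of_multiset (image_mset (frequency F) (mset_set (\<Union>F))))"

lemma frequencies_eq_map:
  assumes "distinct xs" and "set xs = \<Union>F"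
    and "sorted_wrt (\<lambda>x y. frequency F x \<ge> frequency F y) xs"
  shows "frequencies F = map (frequency F) xs"
proof -
  have "mset_set (\<Union>F) = mset xs"
    using assms(1,2) by (metis mset_set_set)
  moreover have "sorted (rev (map (frequency F) xs))"
    using assms(3) by (simp add: sorted_wrt_rev sorted_wrt_map)
  ultimately show ?thesis
    by (simp add: frequencies_def sorted_sort_id flip: mset_map)
      (metis mset_rev rev_rev_ident sorted_list_of_multiset_mset sorted_sort_id)
qed

text \<open>The second entry of the list has index 1. It exists when the ground set has
  at least two elements.\<close>

definition f2 :: "'a set set \<Rightarrow> real" where
  "f2 F = real (frequencies F ! 1) / real (card F)"

definition most_frequent :: "'a set set \<Rightarrow> 'a \<Rightarrow> bool" where
  "most_frequent F m \<longleftrightarrow> m \<in> \<Union>F \<and> (\<forall>x\<in>\<Union>F. frequency F x \<le> frequency F m)"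

definition near_2_cube :: "'a set set \<Rightarrow> bool" where
  "near_2_cube F \<longleftrightarrow> (\<exists>u C. F = {{}, {u}, C} \<and> u \<in> C \<and> card C \<ge> 2)"

text \<open>The argument \<open>m\<close> is the most frequent element that is labelled 1.\<close>

definition two_good :: "'a set set \<Rightarrow> 'a \<Rightarrow> 'a set \<Rightarrow> bool" where
  "two_good F m S \<longleftrightarrow> m \<notin> S \<and> (\<forall>A\<in>F. A \<noteq> {} \<longrightarrow> A \<noteq> {m} \<longrightarrow> S \<inter> A \<noteq> {})"

definition minimal_two_good :: "'a set set \<Rightarrow> 'a \<Rightarrow> 'a set \<Rightarrow> bool" where
  "minimal_two_good F m S \<longleftrightarrow> two_good F m S \<and> (\<forall>T. T \<subset> S \<longrightarrow> \<not> two_good F m T)"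

end

theory Submission
  imports Defs "HOL-Analysis.Harmonic_Numbers" "HOL-Real_Asymp.Real_Asymp"
begin

text \<open>
  The hypotheses are contradictory: \<open>f2 F \<le> 1/3\<close> forces \<open>F\<close> to be a near-2-cube, so the claimed
  bounds hold vacuously. Let \<open>m\<close> be the most frequent element, \<open>n = |F|\<close>, and let \<open>P\<close> be
  \<open>A - {m}\<close> for a uniformly random \<open>A \<in> F\<close>. Its range \<open>G\<close> is union-closed, and since each element
  of \<open>G\<close> has at most two preimages in \<open>F\<close>, the entropy of \<open>P\<close> is \<open>ln n - 2 ln 2 (n - |G|) / n\<close>.
  If \<open>Q\<close> is an independent copy of \<open>P\<close>, then \<open>P \<union> Q\<close> has entropy at most \<open>ln |G|\<close>. On the other
  hand no element lies in \<open>P\<close> with probability above \<open>1/3\<close>, so the entropy form of Gilmer's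
  argument gives \<open>H(P \<union> Q) \<ge> (2/3) \<phi> H(P)\<close> with the golden ratio \<open>\<phi>\<close>. Both estimates together
  fail for \<open>n \<ge> 4\<close>, and \<open>n \<le> 3\<close> leaves only the near-2-cubes.

  Writing \<open>h\<close> for the binary entropy, the analytic core is
  \<open>h(x y) \<ge> \<phi>/2 (x h(y) + y h(x))\<close>. Dividing by \<open>x y\<close> turns it into
  \<open>u(x y) - (1 - \<phi>/2) ln (x y) \<ge> \<phi>/2 (u(x) + u(y))\<close> with \<open>u(t) = -(1-t) ln(1-t) / t\<close>. Concavity of
  \<open>s \<mapsto> u(exp(-s))\<close> reduces it to \<open>x = y\<close>, that is, to \<open>h(t\<^sup>2) \<ge> \<phi> t h(t)\<close>.
\<close>

section \<open>The one-variable inequality\<close>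

definition golden :: real where "golden = (1 + sqrt 5) / 2"

lemma golden_square: "golden * golden = golden + 1"
  by (simp add: golden_def field_simps)

lemma golden_bounds: "1.618 < golden" "golden < 1.62"
proof -
  have "2.236 < sqrt 5" "sqrt 5 < 2.24"
    by (rule real_less_rsqrt, simp add: power2_eq_square) (rule real_less_lsqrt, simp_all add: power2_eq_square)
  then show "1.618 < golden" "golden < 1.62" by (auto simp: golden_def)
qed

text \<open>Transfers signs along a convex function without locating its roots. The second part
  serves contrapositively: once \<open>f\<close> has come back from a value \<le> 0 to a value \<ge>
  0, it cannot be negative further right.\<close>

lemma convex_between:
  fixes f :: "real \<Rightarrow> real"
  assumes "convex_on A f" "x \<in> A" "z \<in> A" "x < y" "y \<le> z" "f x \<le> 0"
  shows "f z \<le> 0 \<Longrightarrow> f y \<le> 0" "f z < 0 \<Longrightarrow> f y < 0"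
proof -
  define u where "u = (y - x) / (z - x)"
  have u: "0 < u" "u \<le> 1" using assms by (auto simp: u_def)
  have "(1-u) * x + u * z = x + u * (z - x)" by (simp add: algebra_simps)
  then have y: "y = (1-u) * x + u * z" using assms by (simp add: u_def)
  have le: "f y \<le> (1-u) * f x + u * f z"
    using convex_onD[OF assms(1), of u x z] u assms y by simp
  have "(1-u) * f x \<le> 0" using u assms by (simp add: mult_le_0_iff)
  moreover have "f z \<le> 0 \<Longrightarrow> u * f z \<le> 0" "f z < 0 \<Longrightarrow> u * f z < 0"
    using u by (auto simp: mult_le_0_iff mult_less_0_iff)
  ultimately show "f z \<le> 0 \<Longrightarrow> f y \<le> 0" "f z < 0 \<Longrightarrow> f y < 0" using le by linarith+
qed

text \<open>
  With the binary entropy \<open>h\<close> in nats, \<open>h(t) = t (ent_quot t - ln t)\<close> and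
  \<open>ent_gap t = (h(t\<^sup>2) - golden t h(t)) / t\<^sup>2\<close>. Up to the positive factors \<open>t\<^sup>3\<close> and \<open>(1 - t\<^sup>2)\<^sup>2\<close>,
  \<open>gap_slope\<close> is minus the derivative of \<open>ent_gap\<close>, and \<open>slope_cubic\<close> the second derivative of
  \<open>gap_slope\<close>.
\<close>

definition ent_quot :: "real \<Rightarrow> real" where "ent_quot t = - ((1-t) * ln (1-t)) / t"
definition ent_gap :: "real \<Rightarrow> real" where
  "ent_gap t = ent_quot (t\<^sup>2) - golden * ent_quot t - (2 - golden) * ln t"
definition gap_slope :: "real \<Rightarrow> real" where
  "gap_slope t = - 2 * ln (1 - t\<^sup>2) + golden * t * ln (1 - t)"
definition gap_slope' :: "real \<Rightarrow> real" where
  "gap_slope' t = 4 * t / (1 - t\<^sup>2) + golden * ln (1 - t) - golden * t / (1 - t)"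
definition slope_cubic :: "real \<Rightarrow> real" where
  "slope_cubic t = (4 - 2 * golden) - 3 * golden * t + 4 * t^2 + golden * t^3"

section \<open>Derivatives of \<open>ent_gap\<close> and its equality point\<close>

lemma square_less_one: "0 \<le> t \<Longrightarrow> t < 1 \<Longrightarrow> t\<^sup>2 < (1::real)"
  by (simp add: power_less_one_iff)

lemma ent_quot_deriv:
  assumes "0 < t" "t < 1"
  shows "(ent_quot has_real_derivative (1/t + ln (1-t) / t\<^sup>2)) (at t)"
  unfolding ent_quot_def
  by (rule derivative_eq_intros refl | use assms in \<open>simp; fail\<close>)+
     (use assms in \<open>simp add: field_simps power2_eq_square\<close>)

lemma ent_gap_deriv:
  assumes "0 < t" "t < 1"
  shows "(ent_gap has_real_derivative - gap_slope t / t^3) (at t)"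
proof -
  have "((\<lambda>t. ent_quot (t\<^sup>2)) has_real_derivative (1/t\<^sup>2 + ln (1-t\<^sup>2) / (t\<^sup>2)\<^sup>2) * (2*t)) (at t)"
    by (rule DERIV_chain2[OF ent_quot_deriv]) (use assms square_less_one[of t] in \<open>auto intro!: derivative_eq_intros\<close>)
  then have "(ent_gap has_real_derivative ((1/t\<^sup>2 + ln (1-t\<^sup>2) / (t\<^sup>2)\<^sup>2) * (2*t)
      - golden * (1/t + ln (1-t) / t\<^sup>2) - (2 - golden) * (1/t))) (at t)"
    unfolding ent_gap_def by (intro DERIV_diff DERIV_cmult ent_quot_deriv DERIV_ln_divide assms)
  also have "(1/t\<^sup>2 + ln (1-t\<^sup>2) / (t\<^sup>2)\<^sup>2) * (2*t)
      - golden * (1/t + ln (1-t) / t\<^sup>2) - (2 - golden) * (1/t) = - gap_slope t / t^3"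
    using assms by (simp add: gap_slope_def field_simps power2_eq_square power3_eq_cube)
  finally show ?thesis .
qed

lemma gap_slope_deriv:
  assumes "0 \<le> t" "t < 1"
  shows "(gap_slope has_real_derivative gap_slope' t) (at t)"
  unfolding gap_slope_def gap_slope'_def
  by (rule derivative_eq_intros refl | use assms square_less_one[of t] in \<open>simp add: field_simps; fail\<close>)+

lemma gap_slope'_deriv:
  assumes "0 \<le> t" "t < 1"
  shows "(gap_slope' has_real_derivative slope_cubic t / (1 - t\<^sup>2)\<^sup>2) (at t)"
proof -
  have nz: "1 - t\<^sup>2 \<noteq> 0" "1 - t \<noteq> 0" "1 + t \<noteq> 0" using square_less_one[of t] assms by auto
  have eq: "1 - t\<^sup>2 = (1-t)*(1+t)" by (simp add: algebra_simps power2_eq_square)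
  have "(gap_slope' has_real_derivative
     ((4 * (1 - t\<^sup>2) + 8*t\<^sup>2) / (1 - t\<^sup>2)\<^sup>2 - golden / (1-t) - golden / (1-t)\<^sup>2)) (at t)"
    unfolding gap_slope'_def
    by (rule derivative_eq_intros refl | use assms nz in \<open>simp; fail\<close>)+
       (use nz in \<open>simp add: field_simps power2_eq_square\<close>)
  moreover have "(4 * (1 - t\<^sup>2) + 8*t\<^sup>2) / (1 - t\<^sup>2)\<^sup>2 - golden / (1-t) - golden / (1-t)\<^sup>2
      = slope_cubic t / (1 - t\<^sup>2)\<^sup>2"
    unfolding eq slope_cubic_def using nz
    by (simp add: divide_simps) (simp add: algebra_simps power2_eq_square power3_eq_cube)
  ultimately show ?thesis by simp
qed

definition inv_golden :: real where "inv_golden = golden - 1"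

lemma inv_golden:
  "3/5 < inv_golden" "inv_golden < 5/8" "golden * inv_golden = 1"
  "inv_golden\<^sup>2 = 1 - inv_golden" "golden = inv_golden + 1"
  using golden_bounds golden_square by (auto simp: inv_golden_def power2_eq_square algebra_simps)

text \<open>At t = \<open>inv_golden\<close> one has 1 - t^2 = t and 1 - t = t^2, so both logarithms
  are multiples of ln t, and they cancel because \<open>golden\<close> t = 1.\<close>

lemma gap_slope_inv_golden: "gap_slope inv_golden = 0"
proof -
  have *: "1 - inv_golden\<^sup>2 = inv_golden" "1 - inv_golden = inv_golden\<^sup>2" using inv_golden by simp_all
  have "gap_slope inv_golden = - 2 * ln inv_golden + golden * inv_golden * ln (inv_golden\<^sup>2)"
    unfolding gap_slope_def *(1) *(2) by simp
  also have "\<dots> = 0" using inv_golden(1,3) by (simp add: ln_realpow)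
  finally show ?thesis .
qed

text \<open>Equality case of h(t^2) \<ge> \<open>golden\<close> t h(t): since t^2 = 1 - t, symmetry
  of h gives h(t^2) = h(t), while \<open>golden\<close> t = 1.\<close>

lemma ent_gap_inv_golden: "ent_gap inv_golden = 0"
proof -
  have *: "1 - inv_golden\<^sup>2 = inv_golden" "1 - inv_golden = inv_golden\<^sup>2" using inv_golden by simp_all
  have inv: "1 / inv_golden = golden" using inv_golden by (simp add: field_simps)
  have "ent_quot (inv_golden\<^sup>2) = - (1 / inv_golden) * ln inv_golden"
    unfolding ent_quot_def *(1) using inv_golden(1) by (simp add: power2_eq_square)
  moreover have "ent_quot inv_golden = - (2 * inv_golden * ln inv_golden)"
    unfolding ent_quot_def *(2) using inv_golden(1) by (simp add: ln_mult_pos power2_eq_square)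
  ultimately have "ent_gap inv_golden =
      - golden * ln inv_golden + 2 * (golden * inv_golden) * ln inv_golden - (2 - golden) * ln inv_golden"
    by (simp add: ent_gap_def inv)
  also have "\<dots> = 0" using inv_golden by (simp add: algebra_simps)
  finally show ?thesis .
qed

text \<open>Convexity allows at most two sign changes, so the signs at 0, \<open>inv_golden\<close>
  and 1 fix the whole sign pattern.\<close>

lemma slope_cubic_convex: "convex_on {0..1} slope_cubic"
  unfolding slope_cubic_def
proof (rule f''_ge0_imp_convex)
  show "((\<lambda>t. (4 - 2 * golden) - 3 * golden * t + 4 * t^2 + golden * t^3) has_real_derivative
     (-3 * golden + 8 * x + 3 * golden * x^2)) (at x)" for x
    by (rule derivative_eq_intros refl)+ simp
  show "((\<lambda>x. -3 * golden + 8 * x + 3 * golden * x^2) has_real_derivative (8 + 6 * golden * x)) (at x)" for x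
    by (rule derivative_eq_intros refl)+ simp
  show "0 \<le> 8 + 6 * golden * x" if "x \<in> {0..1}" for x
    using that golden_bounds by simp
qed simp

text \<open>Reducing powers collapses the cubic to \<open>4 - 7 * inv_golden\<close>, which is
  negative because 3/5 > 4/7.\<close>

lemma slope_cubic_inv_golden: "slope_cubic inv_golden < 0"
proof -
  have "inv_golden^3 = inv_golden * (1 - inv_golden)" using inv_golden(4) by (simp add: power3_eq_cube power2_eq_square)
  also have "\<dots> = 2 * inv_golden - 1" using inv_golden(4) by (simp add: power2_eq_square algebra_simps)
  finally have c: "inv_golden^3 = 2 * inv_golden - 1" .
  have "golden * inv_golden^3 = 1 - inv_golden" using inv_golden(3,4) by (simp add: power3_eq_cube power2_eq_square flip: mult.assoc)
  then have "slope_cubic inv_golden = 4 - 2 * (inv_golden + 1) - 3 * 1 + 4 * (1 - inv_golden) + (1 - inv_golden)"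
    unfolding slope_cubic_def using inv_golden(3,4,5) by (simp add: mult.assoc)
  also have "\<dots> < 0" using inv_golden by simp
  finally show ?thesis .
qed

lemma slope_cubic_signs:
  obtains r1 r2 where "0 < r1" "r1 < inv_golden" "inv_golden < r2" "r2 < 1"
    "\<And>x. 0 \<le> x \<Longrightarrow> x \<le> r1 \<Longrightarrow> 0 \<le> slope_cubic x"
    "\<And>x. r1 \<le> x \<Longrightarrow> x \<le> r2 \<Longrightarrow> slope_cubic x \<le> 0"
    "\<And>x. r2 \<le> x \<Longrightarrow> x \<le> 1 \<Longrightarrow> 0 \<le> slope_cubic x"
proof -
  have cont: "continuous_on S slope_cubic" for S unfolding slope_cubic_def by (intro continuous_intros)
  have P0: "0 < slope_cubic 0" "0 < slope_cubic 1" using golden_bounds by (auto simp: slope_cubic_def)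
  have "\<exists>r1\<ge>0. r1 \<le> inv_golden \<and> slope_cubic r1 = 0"
    using IVT2'[of slope_cubic inv_golden 0 0] P0 slope_cubic_inv_golden inv_golden cont by auto
  then obtain r1 where r1: "0 \<le> r1" "r1 \<le> inv_golden" "slope_cubic r1 = 0" by auto
  have "\<exists>r2\<ge>inv_golden. r2 \<le> 1 \<and> slope_cubic r2 = 0"
    using IVT'[of slope_cubic inv_golden 0 1] P0 slope_cubic_inv_golden inv_golden cont by auto
  then obtain r2 where r2: "inv_golden \<le> r2" "r2 \<le> 1" "slope_cubic r2 = 0" by auto
  have lt: "0 < r1" "r1 < inv_golden" "inv_golden < r2" "r2 < 1"
    using r1 r2 P0 slope_cubic_inv_golden by (metis order_le_less less_irrefl)+
  show ?thesis
  proof (rule that[OF lt])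
    show "0 \<le> slope_cubic x" if "0 \<le> x" "x \<le> r1" for x
    proof (rule ccontr)
      assume "\<not> 0 \<le> slope_cubic x"
      \<comment> \<open>Negative values at \<open>x\<close> and at \<open>inv_golden\<close> would
        make the cubic negative at the root \<open>r1\<close> between them.\<close>
      then have "slope_cubic r1 < 0"
        using convex_between(2)[OF slope_cubic_convex, of x inv_golden r1] that lt slope_cubic_inv_golden inv_golden r1
        by (cases "x = r1") auto
      then show False using r1 by simp
    qed
    show "slope_cubic x \<le> 0" if "r1 \<le> x" "x \<le> r2" for x
      using convex_between(1)[OF slope_cubic_convex, of r1 r2 x] that lt r1 r2
      by (cases "x = r1") auto
    show "0 \<le> slope_cubic x" if "r2 \<le> x" "x \<le> 1" for x
    proof (rule ccontr)
      assume "\<not> 0 \<le> slope_cubic x"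
      then have "slope_cubic r2 < 0"
        using convex_between(2)[OF slope_cubic_convex, of inv_golden x r2] that lt slope_cubic_inv_golden inv_golden r2
        by (cases "x = r2") auto
      then show False using r2 by simp
    qed
  qed
qed

text \<open>Both \<open>gap_slope\<close> and \<open>gap_slope'\<close> vanish at 0, so the sign of
  the second derivative integrates twice.\<close>

lemma gap_slope_nonneg_left:
  assumes "0 \<le> t" "t \<le> r" "r < 1" "\<And>x. 0 \<le> x \<Longrightarrow> x \<le> r \<Longrightarrow> 0 \<le> slope_cubic x"
  shows "0 \<le> gap_slope t"
proof -
  have E1: "0 \<le> gap_slope' x" if "0 \<le> x" "x \<le> r" for x
  proof -
    have "gap_slope' 0 \<le> gap_slope' x"
      by (rule DERIV_nonneg_imp_nondecreasing[OF that(1)])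
         (use that assms gap_slope'_deriv in \<open>fastforce intro!: divide_nonneg_nonneg\<close>)
    then show ?thesis by (simp add: gap_slope'_def)
  qed
  have "gap_slope 0 \<le> gap_slope t"
    by (rule DERIV_nonneg_imp_nondecreasing[OF assms(1)])
       (use assms gap_slope_deriv E1 in fastforce)
  then show ?thesis by (simp add: gap_slope_def)
qed

text \<open>
  \<open>slope_cubic\<close> has signs +, -, +, so \<open>gap_slope\<close> is convex, concave, convex, and with its zeros
  at \<open>0\<close> (double) and \<open>inv_golden\<close> it has signs +, -, + as well. Hence \<open>ent_gap\<close> falls to its
  zero \<open>inv_golden\<close>, rises, and falls again to its limit \<open>0\<close> at \<open>1\<close>.
\<close>

lemma ent_gap_nonneg:
  assumes "0 < t" "t < 1"
  shows "0 \<le> ent_gap t"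
proof -
  obtain r1 r2 where r: "0 < r1" "r1 < inv_golden" "inv_golden < r2" "r2 < 1"
    and P: "\<And>x. 0 \<le> x \<Longrightarrow> x \<le> r1 \<Longrightarrow> 0 \<le> slope_cubic x"
    "\<And>x. r1 \<le> x \<Longrightarrow> x \<le> r2 \<Longrightarrow> slope_cubic x \<le> 0"
    "\<And>x. r2 \<le> x \<Longrightarrow> x \<le> 1 \<Longrightarrow> 0 \<le> slope_cubic x"
    by (rule slope_cubic_signs) blast
  have left: "0 \<le> gap_slope x" if "0 \<le> x" "x \<le> r1" for x
    using gap_slope_nonneg_left[of x r1] that r inv_golden P by auto
  have conc: "convex_on {r1..r2} (\<lambda>x. - gap_slope x)"
  proof (rule f''_ge0_imp_convex)
    fix x assume x: "x \<in> {r1..r2}"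
    show "((\<lambda>x. - gap_slope x) has_real_derivative - gap_slope' x) (at x)"
      by (rule DERIV_minus, rule gap_slope_deriv) (use x r in auto)
    show "((\<lambda>x. - gap_slope' x) has_real_derivative - (slope_cubic x / (1 - x\<^sup>2)\<^sup>2)) (at x)"
      by (rule DERIV_minus, rule gap_slope'_deriv) (use x r in auto)
    show "0 \<le> - (slope_cubic x / (1 - x\<^sup>2)\<^sup>2)"
      using P(2)[of x] x by (auto simp: divide_le_0_iff)
  qed simp
  have conv: "convex_on {r2..<1} gap_slope"
  proof (rule f''_ge0_imp_convex)
    fix x assume x: "x \<in> {r2..<1}"
    show "(gap_slope has_real_derivative gap_slope' x) (at x)"
      by (rule gap_slope_deriv) (use x r in auto)
    show "(gap_slope' has_real_derivative (slope_cubic x / (1 - x\<^sup>2)\<^sup>2)) (at x)"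
      by (rule gap_slope'_deriv) (use x r in auto)
    show "0 \<le> slope_cubic x / (1 - x\<^sup>2)\<^sup>2"
      using P(3)[of x] x by (auto simp: zero_le_divide_iff)
  qed simp
  have E1: "0 \<le> gap_slope x" if "0 \<le> x" "x \<le> inv_golden" for x
  proof (cases "x \<le> r1")
    case False
    then show ?thesis
      using convex_between(1)[OF conc, of r1 inv_golden x] left[of r1] gap_slope_inv_golden r that by auto
  qed (use left that in auto)
  \<comment> \<open>A positive value at \<open>x\<close> would, by concavity and the nonnegative
    value at \<open>r1\<close>, force a positive value at \<open>inv_golden\<close>.\<close>
  have E2: "gap_slope x \<le> 0" if "inv_golden \<le> x" "x \<le> r2" for x
    using convex_between(2)[OF conc, of r1 x inv_golden] left[of r1] gap_slope_inv_golden r that by fastforce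
  have up: "ent_gap a \<le> ent_gap b" if "0 < a" "a \<le> b" "b < 1" "\<And>x. a \<le> x \<Longrightarrow> x \<le> b \<Longrightarrow> gap_slope x \<le> 0" for a b
  proof (rule DERIV_nonneg_imp_nondecreasing[OF that(2)])
    fix x assume x: "a \<le> x" "x \<le> b"
    then show "\<exists>y. (ent_gap has_real_derivative y) (at x) \<and> 0 \<le> y"
      using ent_gap_deriv[of x] that(1,3) that(4)[of x]
      by (intro exI[of _ "- gap_slope x / x^3"]) (auto simp: divide_le_0_iff)
  qed
  have down: "ent_gap b \<le> ent_gap a" if "0 < a" "a \<le> b" "b < 1" "\<And>x. a \<le> x \<Longrightarrow> x \<le> b \<Longrightarrow> 0 \<le> gap_slope x" for a b
  proof (rule DERIV_nonpos_imp_nonincreasing[OF that(2)])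
    fix x assume x: "a \<le> x" "x \<le> b"
    then show "\<exists>y. (ent_gap has_real_derivative y) (at x) \<and> y \<le> 0"
      using ent_gap_deriv[of x] that(1,3) that(4)[of x]
      by (intro exI[of _ "- gap_slope x / x^3"]) (auto simp: zero_le_divide_iff)
  qed
  \<comment> \<open>Beyond \<open>r2\<close> the last sign change of \<open>gap_slope\<close> need
    not be located: if \<open>gap_slope t\<close> \<le> 0, then \<open>ent_gap\<close> rises from
    \<open>inv_golden\<close> up to \<open>t\<close>; otherwise it falls from \<open>t\<close> on
    towards its limit 0 at 1.\<close>
  consider "t \<le> inv_golden" | "inv_golden \<le> t" "t \<le> r2" | "r2 < t" "gap_slope t \<le> 0" | "r2 < t" "0 < gap_slope t"
    by linarith
  then show ?thesis
  proof cases
    case 1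
    then show ?thesis using down[of t inv_golden] E1 ent_gap_inv_golden assms inv_golden by auto
  next
    case 2
    then show ?thesis using up[of inv_golden t] E2 ent_gap_inv_golden assms inv_golden by auto
  next
    case 3
    have "gap_slope x \<le> 0" if "inv_golden \<le> x" "x \<le> t" for x
    proof (cases "x \<le> r2")
      case False
      then show ?thesis
        using convex_between(1)[OF conv, of r2 t x] E2[of r2] 3 r that assms by auto
    qed (use E2 that in auto)
    then show ?thesis using up[of inv_golden t] ent_gap_inv_golden 3 r assms inv_golden by auto
  next
    case 4
    have pos: "0 \<le> gap_slope x" if "t \<le> x" "x < 1" for x
      using convex_between(2)[OF conv, of r2 x t] E2[of r2] 4 r that assms by fastforce
    have "(ent_gap \<longlongrightarrow> 0) (at_left 1)"
      unfolding ent_gap_def ent_quot_def by real_asymp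
    moreover have "eventually (\<lambda>x. ent_gap x \<le> ent_gap t) (at_left 1)"
      using eventually_at_left_real[OF assms(2)]
      by eventually_elim (use down assms pos in auto)
    ultimately show ?thesis
      by (intro tendsto_upperbound[of ent_gap]) auto
  qed
qed

section \<open>The two-variable inequality\<close>

text \<open>
  \<open>split_ent a b\<close> is \<open>(a + b) h(a / (a + b))\<close>, the entropy gained when the weight \<open>a + b\<close> is split
  into \<open>a\<close> and \<open>b\<close>. Its superadditivity expresses that conditioning reduces entropy.
\<close>

definition ent :: "real \<Rightarrow> real" where "ent z = - z * ln z"
definition split_ent :: "real \<Rightarrow> real \<Rightarrow> real" where "split_ent a b = ent a + ent b - ent (a + b)"

lemma ent_0[simp]: "ent 0 = 0" by (simp add: ent_def)
lemma split_ent_0[simp]: "split_ent 0 b = 0" "split_ent a 0 = 0" by (simp_all add: split_ent_def)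

text \<open>In the coordinate s = -ln t products become sums. The second derivative is (t/(1-t) +
  ln(1-t)) / t, nonnegative by ln z \<le> z - 1 at z = 1/(1-t).\<close>

lemma ent_quot_exp_convex: "convex_on {0<..} (\<lambda>s. - ent_quot (exp (- s)))"
proof (rule f''_ge0_imp_convex)
  fix s :: real assume "s \<in> {0<..}"
  then have s: "0 < s" by simp
  define t where "t = exp (- s)"
  have t: "0 < t" "t < 1" using s by (auto simp: t_def)
  have dt: "((\<lambda>s. exp (- s)) has_real_derivative - t) (at s)"
    by (auto intro!: derivative_eq_intros simp: t_def)
  have "((\<lambda>s. - ent_quot (exp (- s))) has_real_derivative - ((1/t + ln (1-t) / t\<^sup>2) * - t)) (at s)"
    by (rule DERIV_minus[OF DERIV_chain2[OF _ dt]]) (use ent_quot_deriv[OF t] in \<open>simp add: t_def\<close>)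
  also have "- ((1/t + ln (1-t) / t\<^sup>2) * - t) = 1 + ln (1 - t) / t"
    using t by (simp add: field_simps power2_eq_square)
  finally show "((\<lambda>s. - ent_quot (exp (- s))) has_real_derivative (1 + ln (1 - exp (-s)) / exp (-s))) (at s)"
    by (simp add: t_def)
  have d1: "((\<lambda>t. 1 + ln (1 - t) / t) has_real_derivative (- 1 / (t * (1-t)) - ln (1-t) / t\<^sup>2)) (at t)"
    by (rule derivative_eq_intros refl | use t in \<open>simp; fail\<close>)+
       (use t in \<open>simp add: field_simps power2_eq_square\<close>)
  have "((\<lambda>s. 1 + ln (1 - exp (-s)) / exp (-s)) has_real_derivative
     ((- 1 / (t * (1-t)) - ln (1-t) / t\<^sup>2) * - t)) (at s)"
    by (rule DERIV_chain2[OF _ dt]) (use d1 in \<open>simp add: t_def\<close>)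
  then show "((\<lambda>s. 1 + ln (1 - exp (-s)) / exp (-s)) has_real_derivative
     ((- 1 / (exp (-s) * (1-exp (-s))) - ln (1-exp (-s)) / (exp (-s))\<^sup>2) * - exp (-s))) (at s)"
    by (simp add: t_def)
  have "- ln (1-t) = ln (1 / (1-t))" using t by (simp add: ln_div)
  also have "\<dots> \<le> 1 / (1-t) - 1" using t by (intro ln_le_minus_one) simp
  also have "\<dots> = t / (1-t)" using t by (simp add: field_simps)
  finally have "0 \<le> (t / (1-t) + ln (1-t)) / t" using t by simp
  also have "\<dots> = (- 1 / (t * (1-t)) - ln (1-t) / t\<^sup>2) * - t"
    using t by (simp add: field_simps power2_eq_square)
  finally show "0 \<le> (- 1 / (exp (-s) * (1-exp (-s))) - ln (1-exp (-s)) / (exp (-s))\<^sup>2) * - exp (-s)"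
    by (simp add: t_def)
qed simp

text \<open>The right side depends only on x y. By Jensen at the midpoint of -ln x and -ln y, the
  left side is largest when both arguments equal the geometric mean t, and there the claim is
  \<open>ent_gap t\<close> \<ge> 0.\<close>

lemma ent_quot_mult_ge:
  assumes "0 < x" "x < 1" "0 < y" "y < 1"
  shows "golden / 2 * (ent_quot x + ent_quot y) \<le> ent_quot (x * y) - (1 - golden / 2) * ln (x * y)"
proof -
  define t where "t = sqrt (x * y)"
  have xy: "0 < x * y" "x * y < 1" using assms mult_strict_mono[of x 1 y 1] by auto
  have t: "0 < t" "t < 1" "t\<^sup>2 = x * y" using xy by (auto simp: t_def)
  have lt: "2 * ln t = ln (x * y)" using t by (simp flip: t(3) add: ln_realpow)
  have "- ent_quot (exp (- ((1 - 1/2) *\<^sub>R (- ln x) + (1/2) *\<^sub>R (- ln y))))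
     \<le> (1 - 1/2) * - ent_quot (exp (- (- ln x))) + (1/2) * - ent_quot (exp (- (- ln y)))"
    by (rule convex_onD[OF ent_quot_exp_convex]) (use assms in auto)
  moreover have "exp (- ((1 - 1/2) *\<^sub>R (- ln x) + (1/2) *\<^sub>R (- ln y))) = t"
  proof -
    have "- ((1 - 1/2) *\<^sub>R (- ln x) + (1/2) *\<^sub>R (- ln y)) = ln t"
      using lt assms by (simp add: ln_mult)
    then show ?thesis using t by simp
  qed
  ultimately have "(ent_quot x + ent_quot y) / 2 \<le> ent_quot t" using assms by simp
  then have "golden * ((ent_quot x + ent_quot y) / 2) \<le> golden * ent_quot t"
    using golden_bounds by (intro mult_left_mono) auto
  moreover have "golden * ent_quot t + (2 - golden) * ln t \<le> ent_quot (x * y)"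
    using ent_gap_nonneg[OF t(1,2)] by (simp add: ent_gap_def t(3))
  moreover have "(2 - golden) * ln t = (1 - golden / 2) * ln (x * y)"
    by (simp flip: lt add: algebra_simps)
  ultimately show ?thesis by simp
qed

section \<open>Product and sum inequalities for \<open>split_ent\<close>\<close>

lemma split_ent_eq_ent_quot:
  assumes "0 < a" "0 < b"
  shows "split_ent a b = a * (ent_quot (a / (a + b)) - ln (a / (a + b)))"
proof -
  have 1: "1 - a / (a + b) = b / (a + b)" using assms by (simp add: field_simps)
  have "a * ent_quot (a / (a + b)) = - (b * ln (b / (a + b)))"
    unfolding ent_quot_def 1 using assms by simp
  then show ?thesis unfolding split_ent_def ent_def
    using assms by (simp add: ln_div algebra_simps)
qed

lemma split_ent_scale:
  assumes "0 \<le> c" "0 \<le> a" "0 \<le> b"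
  shows "split_ent (c * a) (c * b) = c * split_ent a b"
proof (cases "c = 0 \<or> a = 0 \<or> b = 0")
  case False
  then have "0 < c" "0 < a" "0 < b" using assms by auto
  then have "ln (c * a + c * b) = ln c + ln (a + b)" by (simp add: ln_mult_pos flip: distrib_left)
  with \<open>0 < c\<close> \<open>0 < a\<close> \<open>0 < b\<close> show ?thesis by (simp add: split_ent_def ent_def ln_mult_pos algebra_simps)
qed auto

lemma split_ent_nonneg:
  assumes "0 \<le> a" "0 \<le> b"
  shows "0 \<le> split_ent a b"
proof (cases "a = 0 \<or> b = 0")
  case False
  then have "a * ln a \<le> a * ln (a + b)" "b * ln b \<le> b * ln (a + b)" using assms by auto
  then show ?thesis by (simp add: split_ent_def ent_def algebra_simps)
qed auto

text \<open>This is h(x y) \<ge> \<open>golden\<close>/2 (x h(y) + y h(x)) for x = a/(a+a1) and y =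
  b/(b+b1), multiplied by (a+a1)(b+b1). If x or y is 1, outside the range of
  \<open>ent_quot_mult_ge\<close>, scaling and \<open>golden\<close>/2 \<le> 1 suffice.\<close>

lemma split_ent_product_ge:
  assumes "0 \<le> a" "0 \<le> a1" "0 \<le> b" "0 \<le> b1"
  shows "golden / 2 * (a * split_ent b b1 + b * split_ent a a1)
    \<le> split_ent (a * b) ((a + a1) * (b + b1) - a * b)"
proof -
  have half: "golden / 2 * z \<le> z" if "0 \<le> z" for z
    using golden_bounds that by (intro mult_left_le_one_le) auto
  consider "a = 0" | "b = 0" | "a1 = 0" | "b1 = 0" | "0 < a" "0 < b" "0 < a1" "0 < b1"
    using assms by linarith
  then show ?thesis
  proof cases
    case 3
    have "a * (b + b1) - a * b = a * b1" by (simp add: algebra_simps)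
    then show ?thesis using 3 assms half split_ent_scale[of a b b1] split_ent_nonneg[of b b1]
      by simp
  next
    case 4
    have "(a + a1) * b - a * b = b * a1" by (simp add: algebra_simps)
    then show ?thesis using 4 assms half split_ent_scale[of b a a1] split_ent_nonneg[of a a1]
      by (simp add: mult.commute[of a b])
  next
    case 5
    define x where "x = a / (a + a1)"
    define y where "y = b / (b + b1)"
    have xy: "0 < x" "x < 1" "0 < y" "y < 1" using 5 by (auto simp: x_def y_def)
    have xy': "x * y = a * b / ((a + a1) * (b + b1))" by (simp add: x_def y_def)
    have "a * b < (a + a1) * (b + b1)" using 5 by (intro mult_strict_mono) auto
    then have "split_ent (a * b) ((a + a1) * (b + b1) - a * b) = a * b * (ent_quot (x * y) - ln (x * y))"
      using 5 by (subst split_ent_eq_ent_quot) (auto simp: xy')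
    moreover have sum: "a * split_ent b b1 + b * split_ent a a1 = a * b * (ent_quot x + ent_quot y - ln (x * y))"
      using 5 xy unfolding ln_mult_pos[OF xy(1,3)]
      by (subst (1 2) split_ent_eq_ent_quot) (auto simp: x_def y_def algebra_simps)
    moreover have "golden / 2 * (ent_quot x + ent_quot y - ln (x * y)) \<le> ent_quot (x * y) - ln (x * y)"
      using ent_quot_mult_ge[OF xy] by (simp add: algebra_simps)
    then have "a * b * (golden / 2 * (ent_quot x + ent_quot y - ln (x * y)))
        \<le> a * b * (ent_quot (x * y) - ln (x * y))"
      using 5 by (intro mult_left_mono) auto
    moreover have "golden / 2 * (a * split_ent b b1 + b * split_ent a a1)
        = a * b * (golden / 2 * (ent_quot x + ent_quot y - ln (x * y)))"
      unfolding sum by (rule mult.left_commute)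
    ultimately show ?thesis by (simp only:)
  qed auto
qed

text \<open>The left side is a ln(s/a), which is concave in (a, s); the right side is its tangent
  plane at (A, S).\<close>

lemma ent_tangent:
  assumes "0 \<le> a" "a \<le> s" "0 < A" "A \<le> S"
  shows "ent a + a * ln s \<le> a * (ln S - ln A) + s * A / S - a"
proof (cases "a = 0")
  case True
  then show ?thesis using assms by simp
next
  case False
  then have p: "0 < a" "0 < s" "0 < A" "0 < S" using assms by auto
  have "ln (s / a * (A / S)) \<le> s / a * (A / S) - 1" using p by (intro ln_le_minus_one) simp
  moreover have "ln (s / a * (A / S)) = ln s - ln a + (ln A - ln S)"
    using p by (simp add: ln_mult ln_div)
  ultimately have "a * (ln s - ln a + (ln A - ln S)) \<le> a * (s / a * (A / S) - 1)"
    using p by (intro mult_left_mono) auto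
  then show ?thesis using p by (simp add: ent_def algebra_simps)
qed

text \<open>The log sum inequality: both summands are bounded by the tangent plane at the sum of the
  two points, and the correction terms cancel.\<close>

lemma ent_superadd:
  assumes "0 \<le> a" "a \<le> s" "0 \<le> c" "c \<le> r"
  shows "(ent a + a * ln s) + (ent c + c * ln r) \<le> ent (a + c) + (a + c) * ln (s + r)"
proof (cases "a + c = 0")
  case True
  then show ?thesis using assms by (simp add: add_nonneg_eq_0_iff)
next
  case False
  then have p: "0 < a + c" "a + c \<le> s + r" "0 < s + r" using assms by auto
  have "s * (a + c) / (s + r) + r * (a + c) / (s + r) = a + c"
    using p by (simp flip: add_divide_distrib distrib_right)
  then show ?thesis
    using ent_tangent[OF assms(1,2) p(1,2)] ent_tangent[OF assms(3,4) p(1,2)]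
    by (simp add: ent_def algebra_simps)
qed

lemma split_ent_superadd:
  assumes "0 \<le> a" "0 \<le> b" "0 \<le> c" "0 \<le> d"
  shows "split_ent a b + split_ent c d \<le> split_ent (a + c) (b + d)"
  using ent_superadd[of a "a+b" c "c+d"] ent_superadd[of b "a+b" d "c+d"] assms
  by (simp add: split_ent_def ent_def algebra_simps)

lemma split_ent_sum:
  assumes "finite I" "\<And>i. i \<in> I \<Longrightarrow> 0 \<le> a i" "\<And>i. i \<in> I \<Longrightarrow> 0 \<le> b i"
  shows "(\<Sum>i\<in>I. split_ent (a i) (b i)) \<le> split_ent (sum a I) (sum b I)"
  using assms
proof (induction I rule: finite_induct)
  case (insert x I)
  then have "(\<Sum>i\<in>I. split_ent (a i) (b i)) \<le> split_ent (sum a I) (sum b I)" by simp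
  moreover have "split_ent (a x) (b x) + split_ent (sum a I) (sum b I) \<le> split_ent (a x + sum a I) (b x + sum b I)"
    using insert.prems by (intro split_ent_superadd sum_nonneg) auto
  ultimately show ?case using insert.hyps by simp
qed simp

section \<open>Entropy of the union of two independent random sets\<close>

definition set_entropy :: "'a set \<Rightarrow> ('a set \<Rightarrow> real) \<Rightarrow> real" where
  "set_entropy V p = (\<Sum>A\<in>Pow V. ent (p A))"

text \<open>The law of the union of two independent random subsets of \<open>V\<close>, each with law \<open>p\<close>.\<close>

definition union_weight :: "'a set \<Rightarrow> ('a set \<Rightarrow> real) \<Rightarrow> 'a set \<Rightarrow> real" where
  "union_weight V p C = (\<Sum>A\<in>Pow V. \<Sum>B\<in>Pow V. if A \<union> B = C then p A * p B else 0)"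

text \<open>The law of P - {x} when P has law \<open>p\<close>. Only the values at sets without
  \<open>x\<close> have this meaning, and only those are summed.\<close>

definition marginal :: "'a \<Rightarrow> ('a set \<Rightarrow> real) \<Rightarrow> 'a set \<Rightarrow> real" where
  "marginal x p A = p A + p (insert x A)"

section \<open>Adding one element to the ground set\<close>

lemma sum_Pow_insert:
  assumes "finite V" "x \<notin> V"
  shows "(\<Sum>A\<in>Pow (insert x V). f A) = (\<Sum>A\<in>Pow V. f A + f (insert x A))"
proof -
  have inj: "inj_on (insert x) (Pow V)"
    using assms(2) by (intro inj_onI) (metis Pow_iff insert_ident subset_iff)
  have "(\<Sum>A\<in>Pow (insert x V). f A) = (\<Sum>A\<in>Pow V. f A) + (\<Sum>A\<in>insert x ` Pow V. f A)"
    unfolding Pow_insert using assms by (intro sum.union_disjoint) auto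
  also have "(\<Sum>A\<in>insert x ` Pow V. f A) = (\<Sum>A\<in>Pow V. f (insert x A))"
    using inj by (simp add: sum.reindex)
  finally show ?thesis by (simp add: sum.distrib)
qed

text \<open>The chain rule: the last sum is the conditional entropy of the event x \<in> P given P -
  {x}.\<close>

lemma set_entropy_insert:
  assumes "finite V" "x \<notin> V"
  shows "set_entropy (insert x V) p = set_entropy V (marginal x p) + (\<Sum>A\<in>Pow V. split_ent (p A) (p (insert x A)))"
  unfolding set_entropy_def sum_Pow_insert[OF assms] by (simp add: split_ent_def marginal_def flip: sum.distrib)

text \<open>A union misses \<open>x\<close> iff both sets do. Forgetting \<open>x\<close> commutes
  with unions, which gives the weight of \<open>insert x C\<close> as a complement.\<close>

lemma union_weight_insert:
  assumes "finite V" "x \<notin> V" "C \<subseteq> V"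
  shows "union_weight (insert x V) p C = union_weight V p C"
    and "union_weight (insert x V) p (insert x C) = union_weight V (marginal x p) C - union_weight V p C"
proof -
  have *: "A \<union> insert x B \<noteq> C" "insert x A \<union> B \<noteq> C" "insert x A \<union> insert x B \<noteq> C"
    "A \<union> insert x B = insert x C \<longleftrightarrow> A \<union> B = C" "insert x A \<union> B = insert x C \<longleftrightarrow> A \<union> B = C"
    "insert x A \<union> insert x B = insert x C \<longleftrightarrow> A \<union> B = C" "A \<union> B \<noteq> insert x C"
    if "A \<in> Pow V" "B \<in> Pow V" for A B
    using that assms(2,3) by auto
  show "union_weight (insert x V) p C = union_weight V p C"
    unfolding union_weight_def sum_Pow_insert[OF assms(1,2)] sum.distrib[symmetric]
    by (intro sum.cong refl) (simp only: * if_False add_0_right)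
  have "union_weight (insert x V) p (insert x C) + union_weight V p C = union_weight V (marginal x p) C"
    unfolding union_weight_def sum_Pow_insert[OF assms(1,2)] sum.distrib[symmetric]
    by (intro sum.cong refl) (simp only: * if_False, simp add: marginal_def algebra_simps)
  then show "union_weight (insert x V) p (insert x C) = union_weight V (marginal x p) C - union_weight V p C"
    by simp
qed

lemma union_weight_nonneg: "(\<And>A. 0 \<le> p A) \<Longrightarrow> 0 \<le> union_weight V p C"
  unfolding union_weight_def by (intro sum_nonneg) auto

lemma sum_union_groups:
  assumes "finite V"
  shows "(\<Sum>C\<in>Pow V. \<Sum>A\<in>Pow V. \<Sum>B\<in>Pow V. if A \<union> B = C then f A B else 0)
    = (\<Sum>A\<in>Pow V. \<Sum>B\<in>Pow V. f A B)"
proof -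
  have "(\<Sum>C\<in>Pow V. \<Sum>A\<in>Pow V. \<Sum>B\<in>Pow V. if A \<union> B = C then f A B else 0)
    = (\<Sum>A\<in>Pow V. \<Sum>B\<in>Pow V. \<Sum>C\<in>Pow V. if A \<union> B = C then f A B else 0)"
    by (subst sum.swap, rule sum.cong[OF refl], rule sum.swap)
  also have "\<dots> = (\<Sum>A\<in>Pow V. \<Sum>B\<in>Pow V. f A B)"
    using assms by (intro sum.cong refl) (simp add: sum.delta)
  finally show ?thesis .
qed

lemma sum_union_weight:
  assumes "finite V"
  shows "(\<Sum>C\<in>Pow V. union_weight V p C) = (\<Sum>A\<in>Pow V. p A)\<^sup>2"
  unfolding union_weight_def sum_union_groups[OF assms] by (simp add: sum_product power2_eq_square)

text \<open>Gilmer's step for one element. For each pair of traces A, B on V apply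
  \<open>split_ent_product_ge\<close>; by symmetry its two terms have equal sums over all pairs.
  Superadditivity then coarsens the conditioning from the pair (A, B) to the union C.\<close>

lemma union_weight_entropy_step:
  assumes "finite V" "x \<notin> V" "\<And>A. 0 \<le> p A"
  shows "golden * (\<Sum>A\<in>Pow V. p A) * (\<Sum>A\<in>Pow V. split_ent (p A) (p (insert x A)))
    \<le> (\<Sum>C\<in>Pow V. split_ent (union_weight (insert x V) p C) (union_weight (insert x V) p (insert x C)))"
proof -
  let ?q = "marginal x p"
  let ?J = "\<lambda>A. split_ent (p A) (p (insert x A))"
  \<comment> \<open>Among independent pairs with traces A, B, the weight of those whose union misses
    \<open>x\<close> is \<open>f A B\<close>, and of those whose union contains it
    \<open>g A B\<close>.\<close>
  define f where "f A B = p A * p B" for A B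
  define g where "g A B = ?q A * ?q B - p A * p B" for A B
  have f0: "0 \<le> f A B" for A B using assms(3) by (simp add: f_def)
  have g0: "0 \<le> g A B" for A B
    unfolding g_def marginal_def using assms(3) by (simp add: mult_mono)
  have J0: "0 \<le> ?J A" for A using assms(3) by (simp add: split_ent_nonneg)
  have "golden * (\<Sum>A\<in>Pow V. p A) * (\<Sum>A\<in>Pow V. ?J A)
    = golden / 2 * ((\<Sum>A\<in>Pow V. p A) * (\<Sum>B\<in>Pow V. ?J B) + (\<Sum>A\<in>Pow V. ?J A) * (\<Sum>B\<in>Pow V. p B))"
    by simp
  also have "\<dots> = (\<Sum>A\<in>Pow V. \<Sum>B\<in>Pow V. golden / 2 * (p A * ?J B + ?J A * p B))"
    unfolding sum_product unfolding sum.distrib[symmetric] unfolding sum_distrib_left ..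
  also have "\<dots> = (\<Sum>A\<in>Pow V. \<Sum>B\<in>Pow V. golden / 2 * (p A * ?J B + p B * ?J A))"
    by (simp only: mult.commute)
  also have "\<dots> \<le> (\<Sum>A\<in>Pow V. \<Sum>B\<in>Pow V. split_ent (f A B) (g A B))"
    unfolding f_def g_def marginal_def using assms(3) by (intro sum_mono split_ent_product_ge) auto
  also have "\<dots> = (\<Sum>C\<in>Pow V. \<Sum>A\<in>Pow V. \<Sum>B\<in>Pow V. if A \<union> B = C then split_ent (f A B) (g A B) else 0)"
    using assms(1) by (simp add: sum_union_groups)
  \<comment> \<open>The condition may move into the arguments because
    \<open>split_ent 0 0 = 0\<close>.\<close>
  also have "\<dots> = (\<Sum>C\<in>Pow V. \<Sum>A\<in>Pow V. \<Sum>B\<in>Pow V.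
      split_ent (if A \<union> B = C then f A B else 0) (if A \<union> B = C then g A B else 0))"
    by (intro sum.cong refl) simp
  also have "\<dots> \<le> (\<Sum>C\<in>Pow V. split_ent (\<Sum>A\<in>Pow V. \<Sum>B\<in>Pow V. if A \<union> B = C then f A B else 0)
      (\<Sum>A\<in>Pow V. \<Sum>B\<in>Pow V. if A \<union> B = C then g A B else 0))"
  proof (rule sum_mono)
    fix C
    let ?f = "\<lambda>A B. if A \<union> B = C then f A B else 0"
    let ?g = "\<lambda>A B. if A \<union> B = C then g A B else 0"
    have "(\<Sum>B\<in>Pow V. split_ent (?f A B) (?g A B)) \<le> split_ent (\<Sum>B\<in>Pow V. ?f A B) (\<Sum>B\<in>Pow V. ?g A B)" for A
      by (rule split_ent_sum) (use assms(1) f0 g0 in auto)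
    then have "(\<Sum>A\<in>Pow V. \<Sum>B\<in>Pow V. split_ent (?f A B) (?g A B))
      \<le> (\<Sum>A\<in>Pow V. split_ent (\<Sum>B\<in>Pow V. ?f A B) (\<Sum>B\<in>Pow V. ?g A B))"
      by (rule sum_mono)
    also have "\<dots> \<le> split_ent (\<Sum>A\<in>Pow V. \<Sum>B\<in>Pow V. ?f A B) (\<Sum>A\<in>Pow V. \<Sum>B\<in>Pow V. ?g A B)"
      by (rule split_ent_sum) (use assms(1) f0 g0 in \<open>simp_all add: sum_nonneg\<close>)
    finally show "(\<Sum>A\<in>Pow V. \<Sum>B\<in>Pow V. split_ent (?f A B) (?g A B))
      \<le> split_ent (\<Sum>A\<in>Pow V. \<Sum>B\<in>Pow V. ?f A B) (\<Sum>A\<in>Pow V. \<Sum>B\<in>Pow V. ?g A B)" .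
  qed
  also have "\<dots> = (\<Sum>C\<in>Pow V. split_ent (union_weight (insert x V) p C) (union_weight (insert x V) p (insert x C)))"
  proof (intro sum.cong refl arg_cong2[where f = split_ent])
    fix C assume "C \<in> Pow V"
    then have C: "C \<subseteq> V" by simp
    show "(\<Sum>A\<in>Pow V. \<Sum>B\<in>Pow V. if A \<union> B = C then f A B else 0) = union_weight (insert x V) p C"
      unfolding union_weight_insert(1)[OF assms(1,2) C] unfolding union_weight_def f_def ..
    show "(\<Sum>A\<in>Pow V. \<Sum>B\<in>Pow V. if A \<union> B = C then g A B else 0) = union_weight (insert x V) p (insert x C)"
      unfolding union_weight_insert(2)[OF assms(1,2) C] unfolding union_weight_def sum_subtractf[symmetric]
      by (intro sum.cong refl) (simp add: g_def)
  qed
  finally show ?thesis .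
qed

text \<open>Induction on the ground set, with the chain rule applied to P and to the union. The
  hypothesis says that each y is missed with probability at least \<alpha>, and this survives
  passing to the marginal.\<close>

lemma union_weight_entropy:
  assumes "finite V" "\<And>A. 0 \<le> p A" "(\<Sum>A\<in>Pow V. p A) = 1"
    "\<And>y. y \<in> V \<Longrightarrow> \<alpha> \<le> (\<Sum>A\<in>Pow (V - {y}). p A)"
  shows "golden * \<alpha> * set_entropy V p \<le> set_entropy V (union_weight V p)"
  using assms
proof (induction V arbitrary: p rule: finite_induct)
  case empty
  then show ?case by (simp add: set_entropy_def union_weight_def ent_def)
next
  case (insert x V)
  let ?q = "marginal x p"
  let ?J = "\<Sum>A\<in>Pow V. split_ent (p A) (p (insert x A))"
  note V = insert.hyps
  have IH: "golden * \<alpha> * set_entropy V ?q \<le> set_entropy V (union_weight V ?q)"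
  proof (rule insert.IH)
    show "0 \<le> ?q A" for A using insert.prems(1) by (simp add: marginal_def)
    show "(\<Sum>A\<in>Pow V. ?q A) = 1"
      using insert.prems(2) unfolding sum_Pow_insert[OF V] marginal_def .
    fix y assume y: "y \<in> V"
    then have eq: "insert x V - {y} = insert x (V - {y})" using V by auto
    have "\<alpha> \<le> (\<Sum>A\<in>Pow (insert x V - {y}). p A)" using insert.prems(3) y by blast
    then show "\<alpha> \<le> (\<Sum>A\<in>Pow (V - {y}). ?q A)"
      unfolding eq marginal_def using V by (subst (asm) sum_Pow_insert) auto
  qed
  have "insert x V - {x} = V" using V by auto
  then have "\<alpha> \<le> (\<Sum>A\<in>Pow V. p A)" using insert.prems(3)[of x] by simp
  moreover have "0 \<le> ?J" using insert.prems(1) by (intro sum_nonneg split_ent_nonneg)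
  ultimately have "golden * \<alpha> * ?J \<le> golden * (\<Sum>A\<in>Pow V. p A) * ?J"
    using golden_bounds by (intro mult_right_mono mult_left_mono) auto
  also have "\<dots> \<le> (\<Sum>C\<in>Pow V. split_ent (union_weight (insert x V) p C) (union_weight (insert x V) p (insert x C)))"
    using V insert.prems(1) by (intro union_weight_entropy_step)
  finally have step: "golden * \<alpha> * ?J \<le> \<dots>" .
  have "set_entropy V (marginal x (union_weight (insert x V) p)) = set_entropy V (union_weight V ?q)"
    unfolding set_entropy_def marginal_def using union_weight_insert[OF V]
    by (intro sum.cong refl) (simp add: marginal_def[abs_def])
  then show ?case
    using IH step by (simp add: set_entropy_insert[OF V] distrib_left)
qed

lemma entropy_le_ln_card:
  assumes "finite I" "S \<subseteq> I" "S \<noteq> {}" "\<And>i. i \<in> I \<Longrightarrow> 0 \<le> q i"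
    "\<And>i. i \<in> I - S \<Longrightarrow> q i = 0" "sum q I = 1"
  shows "(\<Sum>i\<in>I. ent (q i)) \<le> ln (card S)"
proof -
  have S: "0 < card S" using assms by (metis card_gt_0_iff finite_subset)
  have sum: "sum q S = 1" using sum.mono_neutral_right[of I S q] assms by auto
  have le1: "q i \<le> 1" if "i \<in> S" for i
    using member_le_sum[of i I q] that assms by auto
  have "(\<Sum>i\<in>I. ent (q i)) = (\<Sum>i\<in>S. ent (q i))"
    using assms by (intro sum.mono_neutral_right) auto
  also have "\<dots> \<le> (\<Sum>i\<in>S. q i * ln (card S) + 1 / card S - q i)"
  proof (rule sum_mono)
    fix i assume i: "i \<in> S"
    then show "ent (q i) \<le> q i * ln (card S) + 1 / card S - q i"
      \<comment> \<open>The tangent at the uniform weight 1 / \<open>card S\<close>; its constant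
        terms cancel after summation over \<open>S\<close>.\<close>
      using ent_tangent[of "q i" 1 "1 / card S" 1] assms le1 S by (auto simp: ln_div)
  qed
  also have "\<dots> = ln (card S)"
    using S sum by (simp add: sum.distrib sum_subtractf flip: sum_distrib_right)
  finally show ?thesis .
qed

section \<open>Union-closed families\<close>

text \<open>With x = (n - m)/n and c = 2/3 \<open>golden\<close>, the claim reads ln n + ln(1 - x) <
  c (ln n - 2 x ln 2). Slopes in x compare through 1.08 * 25/18 = 3/2, and the excess c - 1 times ln
  n absorbs the constant 1/10.\<close>

lemma entropy_gap:
  fixes n m :: nat
  assumes "4 \<le> n" "0 < m" "m \<le> n"
  shows "ln m < golden * (2/3) * (ln n - 2 * ln 2 * (real n - real m) / n)"
proof -
  define x where "x = (real n - real m) / n"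
  define c where "c = golden * (2/3)"
  have x: "0 \<le> x" "x < 1" "real m = real n * (1 - x)"
    using assms by (auto simp: x_def field_simps)
  have c: "1.0786 < c" "c < 1.08" using golden_bounds by (auto simp: c_def)
  \<comment> \<open>The tangent of \<open>ln\<close> at \<open>2/3\<close>: the family \<open>{{}, {u}, C}\<close> has \<open>x = 1/3\<close> and is nearly extremal.\<close>
  have "ln (3 / 2) + ln (1 - x) = ln (3 / 2 * (1 - x))"
    using x by (intro ln_mult_pos[symmetric]) auto
  also have "\<dots> \<le> 3 / 2 * (1 - x) - 1" using x by (intro ln_le_minus_one) simp
  also have "\<dots> = 1 / 2 - 3 / 2 * x" by (simp add: field_simps)
  finally have "ln (3 / 2) + ln (1 - x) \<le> 1 / 2 - 3 / 2 * x" .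
  moreover have "2 / 5 \<le> ln (3 / 2 :: real)"
    using ln_inverse_approx_ge[of 2 3] by (simp add: ln_div)
  ultimately have "ln (1 - x) \<le> 1 / 10 - 3 / 2 * x" by linarith
  moreover have "ln m = ln n + ln (1 - x)" using assms x by (simp add: ln_mult_pos)
  moreover have "ln 4 \<le> ln n" using assms by simp
  then have "4 / 3 \<le> ln n" using ln2_ge_two_thirds ln_realpow[of 2 2] by simp
  \<comment> \<open>The margin is slim: 0.0786 * 4/3 = 0.1048. This is where n \<ge> 4
    enters.\<close>
  then have "1 / 10 < (c - 1) * ln n" using c mult_mono[of "0.0786" "c - 1" "4/3" "ln n"] by simp
  moreover have "c * (2 * ln 2 * x) \<le> 3 / 2 * x"
  proof -
    have "c * (2 * ln 2) \<le> 1.08 * (25 / 18)"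
      using c ln2_le_25_over_36 by (intro mult_mono) auto
    then have "c * (2 * ln 2) * x \<le> 3 / 2 * x" using x by (intro mult_right_mono) auto
    then show ?thesis by (simp add: mult.assoc)
  qed
  ultimately have "ln m < c * ln n - c * (2 * ln 2 * x)" by (simp add: left_diff_distrib)
  then show ?thesis by (simp add: c_def x_def right_diff_distrib)
qed

lemma union_closed_card_le_3:
  assumes "set_family F" "union_closed F" "F \<noteq> {}"
    and freq: "\<And>x. x \<in> \<Union>F \<Longrightarrow> x \<noteq> m \<Longrightarrow> 3 * frequency F x \<le> card F"
  shows "card F \<le> 3"
proof (rule ccontr)
  assume "\<not> card F \<le> 3"
  then have n4: "4 \<le> card F" by simp
  define n where "n = card F"
  have finF: "finite F" using assms(1) by (simp add: set_family_def)
  define V where "V = \<Union>F - {m}"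
  define G where "G = (\<lambda>A. A - {m}) ` F"
  define N where "N B = card {A \<in> F. A - {m} = B}" for B
  define p where "p B = N B / n" for B
  have n: "4 \<le> n" "0 < real n" using n4 by (auto simp: n_def)
  have finV: "finite V" using assms(1) by (auto simp: V_def set_family_def)
  have finG: "finite G" using finF by (simp add: G_def)
  have GV: "G \<subseteq> Pow V" by (auto simp: G_def V_def)
  have GU: "A \<union> B \<in> G" if AG: "A \<in> G" "B \<in> G" for A B
  proof -
    obtain A' B' where AB: "A' \<in> F" "B' \<in> F" "A = A' - {m}" "B = B' - {m}"
      using AG unfolding G_def by blast
    then have "A' \<union> B' \<in> F" "A \<union> B = A' \<union> B' - {m}"
      using assms(2) by (auto simp: union_closed_def)
    then show ?thesis by (auto simp: G_def)
  qed
  have N0: "N B = 0" if "B \<notin> G" for B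
  proof -
    have "{A \<in> F. A - {m} = B} = {}" using that unfolding G_def by blast
    then show ?thesis by (simp only: N_def card.empty)
  qed
  \<comment> \<open>Only \<open>B\<close> and \<open>insert m B\<close> can become \<open>B\<close>
    when \<open>m\<close> is deleted.\<close>
  have N12: "N B = 1 \<or> N B = 2" if "B \<in> G" for B
  proof -
    have "{A \<in> F. A - {m} = B} \<subseteq> {B, insert m B}" by auto
    then have "N B \<le> card {B, insert m B}" unfolding N_def by (intro card_mono) auto
    also have "\<dots> \<le> 2" by (simp add: card_insert_if)
    finally have "N B \<le> 2" .
    moreover have "{A \<in> F. A - {m} = B} \<noteq> {}" using that unfolding G_def by blast
    then have "N B \<noteq> 0" unfolding N_def using finF by (simp only: card_eq_0_iff) simp
    ultimately show ?thesis by linarith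
  qed
  have sumN: "(\<Sum>B\<in>Pow W. N B) = card {A \<in> F. A - {m} \<subseteq> W}" if "W \<subseteq> V" for W
  proof -
    have "finite W" using that finV finite_subset by blast
    then have "(\<Sum>B\<in>Pow W. N B) = card (\<Union>B\<in>Pow W. {A \<in> F. A - {m} = B})"
      unfolding N_def using finF by (subst card_UN_disjoint) auto
    also have "(\<Union>B\<in>Pow W. {A \<in> F. A - {m} = B}) = {A \<in> F. A - {m} \<subseteq> W}" by auto
    finally show ?thesis .
  qed
  have sumV: "(\<Sum>B\<in>Pow V. N B) = n"
  proof -
    have "{A \<in> F. A - {m} \<subseteq> V} = F" by (auto simp: V_def)
    then show ?thesis using sumN[of V] by (simp add: n_def)
  qed
  have p0: "0 \<le> p B" for B by (simp add: p_def)
  have p_sum: "(\<Sum>B\<in>Pow V. p B) = 1"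
    using sumV n unfolding p_def by (simp flip: sum_divide_distrib of_nat_sum)
  have p_freq: "2 / 3 \<le> (\<Sum>B\<in>Pow (V - {y}). p B)" if y: "y \<in> V" for y
  proof -
    have "{A \<in> F. A - {m} \<subseteq> V - {y}} = F - {A \<in> F. y \<in> A}"
      using y by (auto simp: V_def)
    then have "(\<Sum>B\<in>Pow (V - {y}). N B) = n - frequency F y"
      using sumN[of "V - {y}"] finF by (simp add: card_Diff_subset n_def frequency_def)
    moreover have "3 * frequency F y \<le> n" using freq[of y] y by (auto simp: V_def n_def)
    ultimately have "2 * n \<le> 3 * (\<Sum>B\<in>Pow (V - {y}). N B)" by linarith
    then have "2 * real n \<le> 3 * (\<Sum>B\<in>Pow (V - {y}). real (N B))"
      by (simp flip: of_nat_sum)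
    then show ?thesis using n unfolding p_def by (simp add: field_simps flip: sum_divide_distrib)
  qed
  have union_weight_zero: "union_weight V p C = 0" if "C \<in> Pow V - G" for C
  proof -
    have "(if A \<union> B = C then p A * p B else 0) = 0" for A B
    proof (cases "A \<in> G \<and> B \<in> G")
      case True
      then show ?thesis using GU[of A B] that by auto
    next
      case False
      then show ?thesis using N0[of A] N0[of B] by (auto simp: p_def)
    qed
    then show ?thesis unfolding union_weight_def by (simp only: sum.neutral_const)
  qed
  have mG: "0 < card G" "card G \<le> n"
    using finF assms(3) by (auto simp: G_def n_def card_gt_0_iff card_image_le)
  have "set_entropy V (union_weight V p) \<le> ln (card G)"
    unfolding set_entropy_def
  proof (rule entropy_le_ln_card)
    show "sum (union_weight V p) (Pow V) = 1" using sum_union_weight[OF finV, of p] p_sum by simp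
    show "0 \<le> union_weight V p C" for C by (rule union_weight_nonneg) (rule p0)
  qed (use finV GV mG(1) union_weight_zero in auto)
  moreover have "set_entropy V p = ln n - 2 * ln 2 * (real n - card G) / n"
  proof -
    have sumG: "(\<Sum>B\<in>G. real (N B)) = n"
    proof -
      have "(\<Sum>B\<in>G. N B) = (\<Sum>B\<in>Pow V. N B)"
        using GV finV N0 by (intro sum.mono_neutral_left) auto
      then show ?thesis using sumV by (simp flip: of_nat_sum)
    qed
    have "set_entropy V p = (\<Sum>B\<in>G. ent (p B))"
      unfolding set_entropy_def using GV finV N0 by (intro sum.mono_neutral_right) (auto simp: p_def)
    \<comment> \<open>An expression linear in \<open>N B\<close> that is exact at both possible
      values 1 and 2; its sum needs only \<open>card G\<close> and the total n.\<close>
    also have "\<dots> = (\<Sum>B\<in>G. (real (N B) * ln n - 2 * ln 2 * (real (N B) - 1)) / n)"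
    proof (rule sum.cong[OF refl])
      fix B assume "B \<in> G"
      then show "ent (p B) = (real (N B) * ln n - 2 * ln 2 * (real (N B) - 1)) / n"
        using N12[of B] n by (auto simp: ent_def p_def ln_div field_simps)
    qed
    also have "\<dots> = ((\<Sum>B\<in>G. real (N B)) * ln n - 2 * ln 2 * ((\<Sum>B\<in>G. real (N B)) - card G)) / n"
      by (simp add: sum_subtractf flip: sum_divide_distrib sum_distrib_left sum_distrib_right)
    also have "\<dots> = ln n - 2 * ln 2 * (real n - card G) / n"
      unfolding sumG using n by (simp add: diff_divide_distrib)
    finally show ?thesis .
  qed
  moreover have "golden * (2/3) * set_entropy V p \<le> set_entropy V (union_weight V p)"
    using union_weight_entropy[OF finV p0 p_sum p_freq] .
  ultimately show False using entropy_gap[OF n(1) mG] by (metis less_le_not_le order_trans)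
qed

section \<open>From at most three sets to a near-2-cube\<close>

lemma union_closed_Union:
  assumes "union_closed F" "finite G" "G \<noteq> {}" "G \<subseteq> F"
  shows "\<Union>G \<in> F"
  using assms(2-4)
proof (induction G rule: finite_ne_induct)
  case (insert A G)
  then show ?case using assms(1) by (simp add: union_closed_def)
qed simp

text \<open>In an enumeration by non-increasing frequency, the head serves as \<open>m\<close>;
  every other element stands at index 1 or later.\<close>

lemma obtain_second_frequency_bound:
  assumes "finite (\<Union>F)" "2 \<le> card (\<Union>F)"
  obtains m where "m \<in> \<Union>F"
    "\<And>x. x \<in> \<Union>F \<Longrightarrow> x \<noteq> m \<Longrightarrow> frequency F x \<le> frequencies F ! 1"
proof -
  obtain ys where ys: "set ys = \<Union>F" "distinct ys"
    using finite_distinct_list[OF assms(1)] by auto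
  define xs where "xs = rev (sort_key (frequency F) ys)"
  have xs: "set xs = \<Union>F" "distinct xs" using ys by (auto simp: xs_def)
  have srt: "sorted_wrt (\<lambda>x y. frequency F x \<ge> frequency F y) xs"
    using sorted_sort_key[of "frequency F" ys] by (simp add: xs_def sorted_wrt_rev sorted_wrt_map)
  have eq: "frequencies F = map (frequency F) xs" by (rule frequencies_eq_map[OF xs(2,1) srt])
  have len: "2 \<le> length xs" using assms(2) xs by (metis distinct_card)
  show ?thesis
  proof (rule that)
    show "xs ! 0 \<in> \<Union>F" unfolding xs(1)[symmetric] using len by (intro nth_mem) linarith
    fix x assume "x \<in> \<Union>F" "x \<noteq> xs ! 0"
    then obtain i where i: "i < length xs" "x = xs ! i" "i \<noteq> 0"
      using xs by (metis in_set_conv_nth)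
    then have "frequency F (xs ! i) \<le> frequency F (xs ! 1)"
      using sorted_wrt_nth_less[OF srt, of 1 i] by (cases "i = 1") auto
    then show "frequency F x \<le> frequencies F ! 1" using i len by (simp add: eq)
  qed
qed

text \<open>An element other than \<open>m\<close> lies in some set, so the frequency bound raises
  \<open>card F\<close> to exactly 3 and allows such an element to lie in one set only. That set is
  the union of the family, so all other sets are contained in {m}.\<close>

lemma near_2_cube_if_frequencies_le:
  assumes "set_family F" "union_closed F" "2 \<le> card (\<Union>F)" "m \<in> \<Union>F"
    and freq: "\<And>x. x \<in> \<Union>F \<Longrightarrow> x \<noteq> m \<Longrightarrow> 3 * frequency F x \<le> card F"
  shows "near_2_cube F"
proof -
  have finF: "finite F" using assms(1) by (simp add: set_family_def)
  have "F \<noteq> {}" using assms(4) by auto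
  then have c3: "card F \<le> 3" and top: "\<Union>F \<in> F"
    using union_closed_card_le_3[OF assms(1,2) _ freq] union_closed_Union[OF assms(2) finF] by auto
  have "\<not> \<Union>F \<subseteq> {m}"
    using card_mono[of "{m}" "\<Union>F"] assms(3) by auto
  then obtain b where b: "b \<in> \<Union>F" "b \<noteq> m" by auto
  have "{A \<in> F. b \<in> A} \<noteq> {}" using b by auto
  then have "1 \<le> frequency F b" using finF by (simp add: frequency_def Suc_le_eq card_gt_0_iff)
  then have c3: "card F = 3" using freq[OF b] c3 by linarith
  have "A \<subseteq> {m}" if A: "A \<in> F" "A \<noteq> \<Union>F" for A
  proof (rule ccontr)
    assume "\<not> A \<subseteq> {m}"
    then obtain x where x: "x \<in> A" "x \<noteq> m" by auto
    have "card {A, \<Union>F} \<le> frequency F x"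
      unfolding frequency_def using finF A x top by (intro card_mono) auto
    then show False using freq[of x] x A c3 by auto
  qed
  then have "F \<subseteq> {{}, {m}, \<Union>F}" by blast
  then have "F = {{}, {m}, \<Union>F}"
    using c3 by (intro card_seteq) (auto simp: card_insert_if)
  then show ?thesis using assms(3,4) unfolding near_2_cube_def by blast
qed

theorem theorem1p3:
  fixes F :: "'a set set"
  assumes "set_family F"
    and "union_closed F"
    and "card (\<Union>F) \<ge> 2"
    and "\<not> near_2_cube F"
    and "f2 F \<le> 1 / 3"
  shows "81 \<le> card F \<and> card F \<le> 113 \<and>
    (\<forall>m S. most_frequent F m \<longrightarrow> minimal_two_good F m S \<longrightarrow> card S = 4)"
proof -
  have fin: "finite (\<Union>F)" "finite F" using assms(1) by (auto simp: set_family_def)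
  obtain m where m: "m \<in> \<Union>F"
    "\<And>x. x \<in> \<Union>F \<Longrightarrow> x \<noteq> m \<Longrightarrow> frequency F x \<le> frequencies F ! 1"
    by (rule obtain_second_frequency_bound[OF fin(1) assms(3)]) (rule that)
  \<comment> \<open>For \<open>card F = 0\<close> the quotient in \<open>f2\<close> would default to
    0 and carry no information.\<close>
  have "0 < card F" using m(1) fin by (auto simp: card_gt_0_iff)
  then have "3 * frequencies F ! 1 \<le> card F"
    using assms(5) by (simp add: f2_def field_simps)
  then have "3 * frequency F x \<le> card F" if "x \<in> \<Union>F" "x \<noteq> m" for x
    using m(2)[OF that] by linarith
  then have "near_2_cube F" using near_2_cube_if_frequencies_le[OF assms(1-3) m(1)] by blast
  then show ?thesis using assms(4) by contradiction
qed

end
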